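(* Let $n=4$ and let $\Lambda_0=(\lambda_{10},\lambda_{20},\lambda_{30},\lambda_{40})\in\mathbb{C}^4$ be the list of eigenvalues (with multiplicity) of a real $4\times4$ matrix (so the list is closed under complex conjugation with multiplicity), with $\sum_{j=1}^4\lambda_{j0}=0$. Then the solution $\Lambda(t)=(\lambda_1(t),\dots,\lambda_4(t))$ of $$\frac{d}{dt}\lambda_i+\lambda_i^2=\frac14\sum_{j=1}^4\lambda_j^2,\qquad i=1,2,3,4,\qquad \Lambda(0)=\Lambda_0,$$ remains bounded for all time if and only if, up to a permutation of its entries, $\Lambda_0$ lies in one of the following sets, where $a,b,c$ denote real numbers: (i) (two pairs of arbitrary complex eigenvalues) $\{(a+ib,\;a-ib,\;-a+ic,\;-a-ic):\ bc\neq 0\}$; (ii) (one pair of complex eigenvalues with two equal real eigenvalues) $\{(a+ib,\;a-ib,\;-a,\;-a):\ b\neq0\}$; (iii) (real eigenvalues) $\{(a+b,\;a-b,\;-a,\;-a):\ a\ge 0,\ b\in[-2a,2a]\}$.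
   Context: The system is the spectral dynamics of the 4D restricted Euler equations: along particle paths, the $\lambda_i$ are the eigenvalues of the real, trace-free velocity gradient matrix. Eigenvalues may be real or complex, complex ones occurring in conjugate pairs. "Remains bounded for all time" means that the solution of the initial value problem exists for all $t\ge 0$ and is bounded on $[0,\infty)$. *)

theory Defs
  imports "HOL-Analysis.Analysis" "Jordan_Normal_Form.Char_Poly"
begin

(* "$" is kept for the components of Cartesian vectors only. *)
no_notation vec_index (infixl \<open>$\<close> 100)

(* The list of eigenvalues with algebraic multiplicity: the characteristic polynomial of the real
   matrix A, read over the complex numbers, splits with exactly the entries of L as its roots. *)
definition eigenvalue_list :: "real mat \<Rightarrow> complex ^ 4 \<Rightarrow> bool" where
  "eigenvalue_list A L \<longleftrightarrow> A \<in> carrier_mat 4 4 \<and>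
     char_poly (map_mat complex_of_real A) = (\<Prod>j\<in>UNIV. [:- (L $ j), 1:])"

(* Solution on the whole half-line [0,\<infinity>), with time derivative one-sided at 0. The right-hand
   side is a polynomial in the components of the vector, so such a solution is unique on [0,\<infinity>). *)
definition restricted_euler_solution :: "complex ^ 4 \<Rightarrow> (real \<Rightarrow> complex ^ 4) \<Rightarrow> bool" where
  "restricted_euler_solution L0 L \<longleftrightarrow> L 0 = L0 \<and>
     (\<forall>t\<ge>0. \<forall>i. ((\<lambda>s. L s $ i) has_vector_derivative
        ((1/4) * (\<Sum>j\<in>UNIV. (L t $ j)\<^sup>2) - (L t $ i)\<^sup>2)) (at t within {0..}))"

definition remains_bounded :: "complex ^ 4 \<Rightarrow> bool" where
  "remains_bounded L0 \<longleftrightarrow> (\<exists>L. restricted_euler_solution L0 L \<and> bounded (L ` {0..}))"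

definition two_complex_pairs :: "(complex ^ 4) set" where
  "two_complex_pairs =
     {vector [Complex a b, Complex a (- b), Complex (- a) c, Complex (- a) (- c)] | a b c.
        b * c \<noteq> 0}"

definition complex_pair_double_real :: "(complex ^ 4) set" where
  "complex_pair_double_real =
     {vector [Complex a b, Complex a (- b), complex_of_real (- a), complex_of_real (- a)] | a b.
        b \<noteq> 0}"

definition all_real :: "(complex ^ 4) set" where
  "all_real =
     {vector [complex_of_real (a + b), complex_of_real (a - b),
              complex_of_real (- a), complex_of_real (- a)] | a b.
        a \<ge> 0 \<and> b \<in> {- 2 * a..2 * a}}"

lemma vector_4 [simp]:
  "(vector [w, x, y, z] :: 'a::zero ^ 4) $ 1 = w"
  "(vector [w, x, y, z] :: 'a::zero ^ 4) $ 2 = x"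
  "(vector [w, x, y, z] :: 'a::zero ^ 4) $ 3 = y"
  "(vector [w, x, y, z] :: 'a::zero ^ 4) $ 4 = z"
  unfolding vector_def by auto

end

theory Submission
  imports Defs
begin

text \<open>
The trace is constant along solutions, hence zero, and differences satisfy
\<open>(\<lambda>\<^sub>i - \<lambda>\<^sub>j)' = - (\<lambda>\<^sub>i + \<lambda>\<^sub>j) (\<lambda>\<^sub>i - \<lambda>\<^sub>j)\<close>. Consequently every product
\<open>(\<lambda>\<^sub>i - \<lambda>\<^sub>j) (\<lambda>\<^sub>k - \<lambda>\<^sub>l)\<close> over a splitting of the four indices into two pairs is conserved. These
invariants decide boundedness in each of the three possible configurations of a conjugation-closed
list (\<open>eigenvalue_list_normal_form\<close>).

Two conjugate pairs \<open>a \<plusminus> i b, - a \<plusminus> i c\<close>, where \<open>c\<close> may vanish: two of the invariants are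
\<open>4 a\<^sup>2 + (b - c)\<^sup>2\<close> and \<open>4 a\<^sup>2 + (b + c)\<^sup>2\<close>, so \<open>4 a\<^sup>2 + b\<^sup>2 + c\<^sup>2\<close> is conserved and the solution is
global and bounded (\<open>remains_bounded_two_pairs\<close>). Global existence comes from a Banach fixed point
argument for norm-preserving quadratic fields
(\<open>norm_preserving_quadratic_ode_solution_exists\<close>).

One conjugate pair with distinct real eigenvalues: the conserved product of the two differences is
nonzero and forces the real part of the pair to grow at least linearly
(\<open>bounded_complex_pair_imp_double_real\<close>).

Four real eigenvalues: if the smallest one is simple, its distance to the next one grows beyond all
bounds (\<open>bounded_real_imp_double_minimum\<close>). If it is at least double, the system
reduces to a scalar Riccati equation with an explicit bounded solution
(\<open>remains_bounded_real\<close>); in this case the trace condition and the ordering give exactly the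
inequalities \<open>0 \<le> a\<close> and \<open>\<bar>b\<bar> \<le> 2 a\<close>.

Both unboundedness arguments need the shape of the initial list, real entries and conjugate pairs,
to persist in time. This follows from uniqueness of bounded solutions
(\<open>restricted_euler_solution_cnj_symmetric\<close>).
\<close>

section \<open>Autonomous differential equations on the half-line\<close>

lemma at_within_atLeast_eq_atLeastAtMost:
  fixes t :: real
  assumes "0 \<le> t" "t < T"
  shows "at t within {0..} = at t within {0..T}"
  by (rule at_within_nhd[of _ "{..<T}"]) (use assms in auto)

lemma integral_has_vector_derivative_atLeast:
  fixes h :: "real \<Rightarrow> 'a::banach"
  assumes "continuous_on {0..} h" "0 \<le> t"
  shows "((\<lambda>u. integral {0..u} h) has_vector_derivative h t) (at t within {0..})"
  using integral_has_vector_derivative[of 0 "t + 1" h t] assms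
    at_within_atLeast_eq_atLeastAtMost[of t "t + 1"] continuous_on_subset[of "{0..}" h "{0..t + 1}"]
  by auto

text \<open>
Global existence for a globally Lipschitz field, by one application of Banach's fixed point
theorem. Writing \<open>x t = exp (k * t) *\<^sub>R y t\<close> with \<open>k\<close> larger than the Lipschitz constant \<open>K\<close>
turns the integral equation into a fixed point equation for a bounded continuous \<open>y\<close>, and the
corresponding operator contracts the supremum norm with factor \<open>K / k\<close>.
\<close>

lemma lipschitz_ode_solution_exists:
  fixes f :: "'a::banach \<Rightarrow> 'a" and x0 :: 'a
  assumes lip: "K-lipschitz_on UNIV f"
  obtains x where "x 0 = x0"
    and "\<And>t. 0 \<le> t \<Longrightarrow> (x has_vector_derivative f (x t)) (at t within {0..})"
proof -
  \<comment> \<open>Any rate above \<open>K\<close> would do.\<close>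
  define k where "k = 2 * K + 1"
  have K0: "0 \<le> K" using lip by (rule lipschitz_on_nonneg)
  then have k0: "0 < k" by (simp add: k_def)
  have K: "norm (f u - f v) \<le> K * norm (u - v)" for u v
    using lipschitz_onD[OF lip, of u v] by (simp add: dist_norm)
  have contf: "continuous_on UNIV f" by (rule lipschitz_on_continuous_on[OF lip])
  define g :: "(real \<Rightarrow>\<^sub>C 'a) \<Rightarrow> real \<Rightarrow> 'a"
    where "g y s = f (exp (k * s) *\<^sub>R y s)" for y s
  have contg: "continuous_on S (g y)" for y S
    unfolding g_def
    by (rule continuous_on_compose2[OF contf]) (auto intro!: continuous_intros)
  have intg: "g y integrable_on {0..t}" for y t
    by (intro integrable_continuous_real contg)
  have exp_int: "((\<lambda>s. C * exp (k * s)) has_integral C * (exp (k * t) - 1) / k) {0..t}"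
    if "0 \<le> t" for t C
  proof -
    have "((\<lambda>s. C * exp (k * s)) has_integral (C * exp (k * t) / k - C * exp (k * 0) / k)) {0..t}"
      by (rule fundamental_theorem_of_calculus)
        (use that k0 in \<open>auto intro!: derivative_eq_intros
            simp flip: has_real_derivative_iff_has_vector_derivative\<close>)
    then show ?thesis by (simp add: algebra_simps diff_divide_distrib)
  qed
  have exp_bound: "exp (- (k * t)) * (C * (exp (k * t) - 1) / k) \<le> C / k" if "0 \<le> C" for t C
  proof -
    have "exp (- (k * t)) * (C * (exp (k * t) - 1) / k) = (1 - exp (- (k * t))) * (C / k)"
      by (simp add: exp_minus field_simps)
    also have "\<dots> \<le> 1 * (C / k)"
      by (rule mult_right_mono) (use that k0 in auto)
    finally show ?thesis by simp
  qed
  \<comment> \<open>The type of bounded continuous functions has domain the whole line, so the operator is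
      extended to negative times by its value at \<open>0\<close>.\<close>
  define T where "T y t = exp (- (k * max 0 t)) *\<^sub>R (x0 + integral {0..max 0 t} (g y))" for y t
  have bnd: "norm (exp (- (k * t)) *\<^sub>R integral {0..t} h) \<le> C / k"
    if "0 \<le> t" "0 \<le> C" "h integrable_on {0..t}"
      "\<And>s. 0 \<le> s \<Longrightarrow> norm (h s) \<le> C * exp (k * s)" for t C and h :: "real \<Rightarrow> 'a"
  proof -
    have "norm (integral {0..t} h) \<le> integral {0..t} (\<lambda>s. C * exp (k * s))"
      by (rule integral_norm_bound_integral) (use that exp_int in \<open>auto intro: has_integral_integrable\<close>)
    also have "\<dots> = C * (exp (k * t) - 1) / k"
      using exp_int[OF that(1)] by (rule integral_unique)
    finally have "exp (- (k * t)) * norm (integral {0..t} h)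
        \<le> exp (- (k * t)) * (C * (exp (k * t) - 1) / k)"
      by (rule mult_left_mono) simp
    with exp_bound[OF that(2), of t] show ?thesis by simp
  qed
  have Tb: "T y \<in> bcontfun" for y
  proof (rule bcontfun_normI)
    have "continuous_on {0..} (\<lambda>u. integral {0..u} (g y))"
      unfolding continuous_on_eq_continuous_within
      by (auto intro!: has_vector_derivative_continuous integral_has_vector_derivative_atLeast contg)
    then have "continuous_on UNIV (\<lambda>t. integral {0..max 0 t} (g y))"
      by (rule continuous_on_compose2[where f = "\<lambda>t. max 0 t"]) (auto intro!: continuous_intros)
    then show "continuous_on UNIV (T y)"
      unfolding T_def by (intro continuous_intros)
    fix t :: real
    define C where "C = norm (f 0) + K * norm y"
    have C0: "0 \<le> C" using K0 by (simp add: C_def)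
    have "norm (g y s) \<le> C * exp (k * s)" if "0 \<le> s" for s
    proof -
      have e1: "1 \<le> exp (k * s)" using that k0 by simp
      have "norm (g y s) \<le> norm (f 0) + K * norm (exp (k * s) *\<^sub>R y s)"
        using K[of "exp (k * s) *\<^sub>R y s" 0] norm_triangle_sub[of "g y s" "f 0"]
        by (simp add: g_def)
      also have "\<dots> \<le> norm (f 0) * exp (k * s) + K * (exp (k * s) * norm y)"
        using e1 K0 norm_bounded[of y s] mult_left_mono[OF e1, of "norm (f 0)"]
        by (intro add_mono) (auto intro!: mult_left_mono)
      finally show ?thesis by (simp add: C_def algebra_simps)
    qed
    then have "norm (exp (- (k * max 0 t)) *\<^sub>R integral {0..max 0 t} (g y)) \<le> C / k"
      by (intro bnd intg C0) auto
    moreover have "norm (exp (- (k * max 0 t)) *\<^sub>R x0) \<le> norm x0"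
      using k0 by (simp add: mult_left_le_one_le)
    ultimately show "norm (T y t) \<le> norm x0 + C / k"
      unfolding T_def scaleR_add_right by (intro norm_triangle_mono)
  qed
  have "\<exists>!y. Bcontfun (T y) = y"
  proof (rule banach_fix_type)
    show "0 \<le> K / k" "K / k < 1" using K0 by (auto simp: k_def)
    show "\<forall>y z. dist (Bcontfun (T y)) (Bcontfun (T z)) \<le> K / k * dist y z"
    proof (intro allI dist_bound)
      fix y z :: "real \<Rightarrow>\<^sub>C 'a" and t :: real
      have eq: "T y t - T z t
          = exp (- (k * max 0 t)) *\<^sub>R integral {0..max 0 t} (\<lambda>s. g y s - g z s)"
        by (simp add: T_def integral_diff[OF intg intg] algebra_simps)
      have "norm (T y t - T z t) \<le> (K * dist y z) / k"
        unfolding eq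
      proof (rule bnd)
        show "norm (g y s - g z s) \<le> K * dist y z * exp (k * s)" for s
        proof -
          have "norm (g y s - g z s) \<le> K * norm (exp (k * s) *\<^sub>R y s - exp (k * s) *\<^sub>R z s)"
            unfolding g_def by (rule K)
          also have "\<dots> = K * (exp (k * s) * dist (y s) (z s))"
            by (simp add: dist_norm flip: scaleR_diff_right)
          also have "\<dots> \<le> K * (exp (k * s) * dist y z)"
            using K0 dist_bounded[of y s z] by (intro mult_left_mono) auto
          finally show ?thesis by (simp add: algebra_simps)
        qed
      qed (use K0 intg in \<open>auto intro: integrable_diff\<close>)
      then show "dist (Bcontfun (T y) t) (Bcontfun (T z) t) \<le> K / k * dist y z"
        by (simp add: Bcontfun_inverse[OF Tb] dist_norm)
    qed
  qed
  then obtain y where y: "Bcontfun (T y) = y" by blast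
  have yT: "apply_bcontfun y = T y"
    using Bcontfun_inverse[OF Tb, of y] y by simp
  define x where "x t = x0 + integral {0..t} (g y)" for t
  have xy: "exp (k * t) *\<^sub>R y t = x t" if "0 \<le> t" for t
    using that by (simp add: yT T_def x_def exp_minus max_def)
  show ?thesis
  proof
    show "x 0 = x0" by (simp add: x_def)
    fix t :: real assume t: "0 \<le> t"
    have "(x has_vector_derivative 0 + g y t) (at t within {0..})"
      unfolding x_def
      by (intro has_vector_derivative_add integral_has_vector_derivative_atLeast contg t)
        (rule has_vector_derivative_const)
    then show "(x has_vector_derivative f (x t)) (at t within {0..})"
      using xy[OF t] by (simp add: g_def)
  qed
qed

lemma mvt_atLeast:
  fixes g g' :: "real \<Rightarrow> real"
  assumes "\<And>t. 0 \<le> t \<Longrightarrow> (g has_vector_derivative g' t) (at t within {0..})" "0 \<le> t"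
  obtains s where "0 \<le> s" "s \<le> t" "g t - g 0 = t * g' s"
proof -
  have "\<exists>s\<in>{0..t}. g t - g 0 = (\<lambda>h. h *\<^sub>R g' s) (t - 0)"
  proof (rule mvt_very_simple)
    fix s assume s: "0 \<le> s" "s \<le> t"
    then show "(g has_derivative (\<lambda>h. h *\<^sub>R g' s)) (at s within {0..t})"
      using assms(1)[of s] by (auto simp: has_vector_derivative_def intro: has_derivative_subset)
  qed (rule assms)
  then show ?thesis using that by auto
qed

lemma has_vector_derivative_atLeast_zero_imp_constant:
  fixes g :: "real \<Rightarrow> 'a::real_normed_vector"
  assumes "\<And>t. 0 \<le> t \<Longrightarrow> (g has_vector_derivative 0) (at t within {0..})" "0 \<le> t"
  shows "g t = g 0"
proof -
  obtain c where "\<And>s. s \<in> {0..} \<Longrightarrow> g s = c"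
    using has_vector_derivative_zero_constant[of "{0..}" g] assms(1) by auto
  then show ?thesis using assms(2) by simp
qed

lemma derivative_bounded_below_imp_unbounded:
  fixes g g' :: "real \<Rightarrow> real"
  assumes "\<And>t. 0 \<le> t \<Longrightarrow> (g has_vector_derivative g' t) (at t within {0..})"
    and "\<And>t. 0 \<le> t \<Longrightarrow> e \<le> g' t" "0 < e"
  shows "\<not> bounded (g ` {0..})"
proof
  assume "bounded (g ` {0..})"
  then obtain M where M: "\<And>t. 0 \<le> t \<Longrightarrow> \<bar>g t\<bar> \<le> M"
    by (auto simp: bounded_iff)
  define t where "t = (2 * M + 1) / e"
  have t: "0 \<le> t" using M[of 0] assms(3) by (simp add: t_def)
  obtain s where s: "0 \<le> s" "g t - g 0 = t * g' s"
    using mvt_atLeast[of g g' t] assms(1) t by blast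
  have "t * e \<le> t * g' s" using assms(2)[OF s(1)] t by (rule mult_left_mono)
  moreover have "t * e = 2 * M + 1" using assms(3) by (simp add: t_def)
  ultimately show False using M[of 0] M[OF t] s(2) by linarith
qed

text \<open>
In particular \<open>g\<close> keeps the sign of its initial value, which is how the order of real eigenvalues
is seen to be preserved.
\<close>

lemma scalar_linear_ode_solution:
  fixes g h :: "real \<Rightarrow> real"
  assumes g: "\<And>t. 0 \<le> t \<Longrightarrow> (g has_vector_derivative h t * g t) (at t within {0..})"
    and h: "continuous_on {0..} h" and t: "0 \<le> t"
  shows "g t = g 0 * exp (integral {0..t} h)"
proof -
  let ?H = "\<lambda>u. integral {0..u} h"
  have "((\<lambda>u. g u * exp (- ?H u)) has_vector_derivative 0) (at s within {0..})"
    if s: "0 \<le> s" for s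
    using g[OF s] integral_has_vector_derivative_atLeast[OF h s]
    unfolding has_real_derivative_iff_has_vector_derivative[symmetric]
    by (auto intro!: derivative_eq_intros)
  from has_vector_derivative_atLeast_zero_imp_constant[OF this t]
  have "g t * exp (- ?H t) = g 0" by simp
  then show ?thesis by (simp add: exp_minus field_simps)
qed

text \<open>
Gronwall's argument: \<open>exp (- 2 * K * t) * (norm (x t - y t))\<^sup>2\<close> is nonincreasing.
\<close>

lemma lipschitz_ode_solution_unique:
  fixes x y :: "real \<Rightarrow> 'a::real_inner"
  assumes lip: "K-lipschitz_on S f"
    and x: "\<And>t. 0 \<le> t \<Longrightarrow> (x has_vector_derivative f (x t)) (at t within {0..})"
    and y: "\<And>t. 0 \<le> t \<Longrightarrow> (y has_vector_derivative f (y t)) (at t within {0..})"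
    and S: "\<And>t. 0 \<le> t \<Longrightarrow> x t \<in> S" "\<And>t. 0 \<le> t \<Longrightarrow> y t \<in> S"
    and "x 0 = y 0" and t: "0 \<le> t"
  shows "x t = y t"
proof -
  define E where "E s = exp (- (2 * K * s)) * ((x s - y s) \<bullet> (x s - y s))" for s
  define E' where "E' s = exp (- (2 * K * s)) * (2 * ((x s - y s) \<bullet> (f (x s) - f (y s)))
      - 2 * K * ((x s - y s) \<bullet> (x s - y s)))" for s
  have E: "(E has_vector_derivative E' s) (at s within {0..})" if "0 \<le> s" for s
    unfolding E_def E'_def has_vector_derivative_def
    by (rule derivative_eq_intros x[OF that, unfolded has_vector_derivative_def]
          y[OF that, unfolded has_vector_derivative_def] refl)+
      (auto simp: fun_eq_iff algebra_simps inner_commute)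
  have neg: "E' s \<le> 0" if "0 \<le> s" for s
  proof -
    have "(x s - y s) \<bullet> (f (x s) - f (y s)) \<le> norm (x s - y s) * norm (f (x s) - f (y s))"
      by (rule norm_cauchy_schwarz)
    also have "\<dots> \<le> norm (x s - y s) * (K * norm (x s - y s))"
      using lipschitz_onD[OF lip S(1)[OF that] S(2)[OF that]]
      by (intro mult_left_mono) (auto simp: dist_norm)
    also have "\<dots> = K * ((x s - y s) \<bullet> (x s - y s))"
      by (simp add: dot_square_norm power2_eq_square)
    finally show ?thesis
      unfolding E'_def by (intro mult_nonneg_nonpos) auto
  qed
  obtain s where "0 \<le> s" "E t - E 0 = t * E' s"
    using mvt_atLeast[of E E' t] E t by blast
  then have "E t \<le> E 0" using neg[of s] t mult_nonneg_nonpos[of t "E' s"] by simp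
  also have "E 0 = 0" using assms(6) by (simp add: E_def)
  finally have "(x t - y t) \<bullet> (x t - y t) \<le> 0"
    by (simp add: E_def mult_le_0_iff)
  then show ?thesis
    by (metis antisym inner_eq_zero_iff inner_ge_zero eq_iff_diff_eq_0)
qed

lemma bilinear_diagonal_lipschitz_on_cball:
  fixes B :: "'a::euclidean_space \<Rightarrow> 'a \<Rightarrow> 'b::real_normed_vector"
  assumes "bilinear B" "0 \<le> R"
  obtains K where "K-lipschitz_on (cball 0 R) (\<lambda>x. B x x)"
proof -
  from bilinear_bounded_pos[OF assms(1)] obtain C
    where C: "0 < C" "\<And>x y. norm (B x y) \<le> C * norm x * norm y" by blast
  show ?thesis
  proof
    show "(2 * C * R)-lipschitz_on (cball 0 R) (\<lambda>x. B x x)"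
    proof (rule lipschitz_onI)
      fix x y :: 'a assume xy: "x \<in> cball 0 R" "y \<in> cball 0 R"
      have "B x x - B y y = B (x - y) x + B y (x - y)"
        using assms(1) by (simp add: bilinear_lsub bilinear_rsub)
      then have "norm (B x x - B y y) \<le> C * norm (x - y) * norm x + C * norm y * norm (x - y)"
        using C(2)[of "x - y" x] C(2)[of y "x - y"] norm_triangle_ineq[of "B (x - y) x" "B y (x - y)"]
        by simp
      also have "\<dots> \<le> C * norm (x - y) * R + C * R * norm (x - y)"
        using xy C(1) by (intro add_mono mult_left_mono mult_right_mono) auto
      finally show "dist (B x x) (B y y) \<le> 2 * C * R * dist x y"
        by (simp add: dist_norm algebra_simps)
    qed (use C assms in auto)
  qed
qed

lemma closest_point_cball_0:
  fixes x :: "'a::euclidean_space"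
  assumes "0 < R"
  shows "closest_point (cball 0 R) x = (if norm x \<le> R then x else (R / norm x) *\<^sub>R x)"
proof (cases "norm x \<le> R")
  case True
  then show ?thesis by (simp add: closest_point_self)
next
  case False
  have "(R / norm x) *\<^sub>R x = closest_point (cball 0 R) x"
  proof (rule closest_point_unique)
    show "(R / norm x) *\<^sub>R x \<in> cball 0 R" using False assms by auto
    have "dist x ((R / norm x) *\<^sub>R x) = norm ((1 - R / norm x) *\<^sub>R x)"
      by (simp add: dist_norm scaleR_diff_left)
    also have "\<dots> = (1 - R / norm x) * norm x"
      using False assms unfolding norm_scaleR by (subst abs_of_nonneg) (auto simp: divide_le_eq)
    also have "\<dots> = norm x - R"
      using False assms by (cases "x = 0") (auto simp: left_diff_distrib)
    also have "norm x - R \<le> dist x z" if "z \<in> cball 0 R" for z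
      using norm_triangle_sub[of x z] that by (simp add: dist_norm)
    finally show "\<forall>z\<in>cball 0 R. dist x ((R / norm x) *\<^sub>R x) \<le> dist x z" by blast
  qed auto
  with False show ?thesis by simp
qed

text \<open>
A quadratic field that is orthogonal to the position vector has global solutions, which stay on a
sphere about the origin. The field is made globally Lipschitz by composing it with the nearest-point
projection \<open>r\<close> onto a ball. Since \<open>r x\<close> is a positive multiple of \<open>x\<close>, the modified field is still
orthogonal to \<open>x\<close>; hence its solutions never leave the ball, where nothing was modified.
\<close>

lemma norm_preserving_quadratic_ode_solution_exists:
  fixes B :: "'a::euclidean_space \<Rightarrow> 'a \<Rightarrow> 'a"
  assumes bil: "bilinear B" and orth: "\<And>x. x \<bullet> B x x = 0"
  obtains x where "x 0 = x0"
    and "\<And>t. 0 \<le> t \<Longrightarrow> (x has_vector_derivative B (x t) (x t)) (at t within {0..})"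
    and "\<And>t. 0 \<le> t \<Longrightarrow> norm (x t) = norm x0"
proof -
  define R where "R = norm x0 + 1"
  have R: "0 < R" by (simp add: R_def add_nonneg_pos)
  define r where "r = closest_point (cball (0::'a) R)"
  obtain K where K: "K-lipschitz_on (cball 0 R) (\<lambda>x. B x x)"
    using bilinear_diagonal_lipschitz_on_cball[OF bil, of R] R by auto
  have r_lip: "1-lipschitz_on UNIV r"
    unfolding r_def using closest_point_lipschitz[of "cball (0::'a) R"] R
    by (intro lipschitz_onI) auto
  have "range r \<subseteq> cball 0 R"
    unfolding r_def using closest_point_in_set[of "cball (0::'a) R"] R by force
  then have "(K * 1)-lipschitz_on UNIV ((\<lambda>x. B x x) \<circ> r)"
    by (intro lipschitz_on_compose r_lip lipschitz_on_subset[OF K])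
  from lipschitz_ode_solution_exists[OF this, of x0] obtain x
    where x: "x 0 = x0"
      and der: "\<And>t. 0 \<le> t \<Longrightarrow> (x has_vector_derivative B (r (x t)) (r (x t))) (at t within {0..})"
    by (auto simp: o_def)
  have orth': "y \<bullet> B (r y) (r y) = 0" for y
    using orth[of y] bilinear_lmul[OF bil] bilinear_rmul[OF bil]
    by (simp add: r_def closest_point_cball_0[OF R])
  have "((\<lambda>s. x s \<bullet> x s) has_vector_derivative 0) (at t within {0..})" if "0 \<le> t" for t
    unfolding has_vector_derivative_def
    by (rule derivative_eq_intros der[OF that, unfolded has_vector_derivative_def] refl)+
      (use orth'[of "x t"] in \<open>auto simp: fun_eq_iff inner_commute\<close>)
  from has_vector_derivative_atLeast_zero_imp_constant[OF this]
  have n: "norm (x t) = norm x0" if "0 \<le> t" for t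
    using that by (simp add: x norm_eq_sqrt_inner)
  have "r (x t) = x t" if "0 \<le> t" for t
    unfolding r_def by (rule closest_point_self) (simp add: n[OF that] R_def)
  then show ?thesis using that[of x] x der n by auto
qed

section \<open>Uniqueness and symmetry of bounded solutions\<close>

lemma has_vector_derivative_vecI:
  fixes f :: "real \<Rightarrow> 'a::euclidean_space ^ 'n"
  assumes "\<And>i. ((\<lambda>s. f s $ i) has_vector_derivative f' $ i) (at t within S)"
  shows "(f has_vector_derivative f') (at t within S)"
  unfolding has_vector_derivative_def
proof (subst has_derivative_componentwise_within, rule ballI)
  fix b :: "'a ^ 'n" assume "b \<in> Basis"
  then obtain i u where b: "b = axis i u" by (auto simp: Basis_vec_def)
  have "((\<lambda>s. f s $ i \<bullet> u) has_derivative (\<lambda>h. (h *\<^sub>R f' $ i) \<bullet> u)) (at t within S)"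
    by (rule has_derivative_inner_left)
      (use assms[of i] in \<open>simp add: has_vector_derivative_def\<close>)
  then show "((\<lambda>s. f s \<bullet> b) has_derivative (\<lambda>h. (h *\<^sub>R f') \<bullet> b)) (at t within S)"
    by (simp add: b inner_axis)
qed

lemma bounded_vec_image_iff:
  fixes f :: "'b \<Rightarrow> 'a::real_normed_vector ^ 'n"
  shows "bounded (f ` S) \<longleftrightarrow> (\<forall>i. bounded ((\<lambda>s. f s $ i) ` S))"
proof
  assume "bounded (f ` S)"
  then obtain M where M: "\<And>s. s \<in> S \<Longrightarrow> norm (f s) \<le> M" by (auto simp: bounded_iff)
  have "norm (f s $ i) \<le> M" if "s \<in> S" for s i
    using Finite_Cartesian_Product.norm_nth_le[of "f s" i] M[OF that] by linarith
  then show "\<forall>i. bounded ((\<lambda>s. f s $ i) ` S)" by (auto simp: bounded_iff)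
next
  assume "\<forall>i. bounded ((\<lambda>s. f s $ i) ` S)"
  then obtain M where M: "\<And>i s. s \<in> S \<Longrightarrow> norm (f s $ i) \<le> M i"
    by (simp add: bounded_iff) metis
  have "norm (f s) \<le> (\<Sum>i\<in>UNIV. M i)" if "s \<in> S" for s
    unfolding norm_vec_def
    by (rule order_trans[OF L2_set_le_sum]) (auto intro: sum_mono M that)
  then show "bounded (f ` S)" by (auto simp: bounded_iff)
qed

lemma bounded_Re_component:
  fixes f :: "'b \<Rightarrow> complex ^ 'n"
  assumes "bounded (f ` S)"
  shows "bounded ((\<lambda>s. Re (f s $ i)) ` S)"
  using assms bounded_linear_image[OF _ bounded_linear_Re, of "(\<lambda>s. f s $ i) ` S"]
  by (simp add: bounded_vec_image_iff image_image)

text \<open>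
The symmetric bilinear map whose value on the diagonal is the right-hand side of the system.
\<close>

definition euler_bilinear :: "complex ^ 4 \<Rightarrow> complex ^ 4 \<Rightarrow> complex ^ 4" where
  "euler_bilinear x y = (\<chi> i. (1/4) * (\<Sum>j\<in>UNIV. x $ j * y $ j) - x $ i * y $ i)"

lemma bilinear_euler_bilinear: "bilinear euler_bilinear"
proof -
  have "linear (\<lambda>y. euler_bilinear x y)" for x
  proof (rule linearI)
    show "euler_bilinear x (y + z) = euler_bilinear x y + euler_bilinear x z" for y z
      by (simp add: Finite_Cartesian_Product.vec_eq_iff euler_bilinear_def distrib_left sum.distrib)
    show "euler_bilinear x (c *\<^sub>R y) = c *\<^sub>R euler_bilinear x y" for c y
      by (simp add: Finite_Cartesian_Product.vec_eq_iff euler_bilinear_def scaleR_diff_right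
          flip: scaleR_sum_right)
  qed
  moreover have "euler_bilinear x y = euler_bilinear y x" for x y
    by (simp add: euler_bilinear_def mult.commute)
  ultimately show ?thesis by (simp add: bilinear_def)
qed

lemma restricted_euler_solution_has_vector_derivative:
  assumes "restricted_euler_solution L0 L" "0 \<le> t"
  shows "(L has_vector_derivative euler_bilinear (L t) (L t)) (at t within {0..})"
  using assms
  by (intro has_vector_derivative_vecI)
    (simp add: restricted_euler_solution_def euler_bilinear_def power2_eq_square)

lemma restricted_euler_solution_unique:
  assumes L: "restricted_euler_solution L0 L" "bounded (L ` {0..})"
    and M: "restricted_euler_solution L0 M" "bounded (M ` {0..})" and t: "0 \<le> t"
  shows "L t = M t"
proof -
  obtain R where R: "0 < R" "\<And>s. 0 \<le> s \<Longrightarrow> norm (L s) \<le> R" "\<And>s. 0 \<le> s \<Longrightarrow> norm (M s) \<le> R"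
    using bounded_Un[of "L ` {0..}" "M ` {0..}"] L(2) M(2) unfolding bounded_pos by auto
  obtain K where "K-lipschitz_on (cball 0 R) (\<lambda>x. euler_bilinear x x)"
    using bilinear_diagonal_lipschitz_on_cball[OF bilinear_euler_bilinear, of R] R(1) by auto
  from lipschitz_ode_solution_unique[OF this, of L M t] show ?thesis
    using restricted_euler_solution_has_vector_derivative L(1) M(1) R t
    by (auto simp: restricted_euler_solution_def)
qed

lemma restricted_euler_solution_permute:
  assumes "restricted_euler_solution L0 L" "p permutes UNIV"
  shows "restricted_euler_solution (\<chi> i. L0 $ p i) (\<lambda>t. \<chi> i. L t $ p i)"
proof -
  have "(\<Sum>j\<in>UNIV. (L t $ p j)\<^sup>2) = (\<Sum>j\<in>UNIV. (L t $ j)\<^sup>2)" for t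
    using sum.permute[OF assms(2), of "\<lambda>j. (L t $ j)\<^sup>2"] by (simp add: o_def)
  then show ?thesis
    using assms(1) by (auto simp: restricted_euler_solution_def)
qed

lemma remains_bounded_permute:
  assumes "remains_bounded L0" "p permutes UNIV"
  shows "remains_bounded (\<chi> i. L0 $ p i)"
proof -
  obtain L where L: "restricted_euler_solution L0 L" "bounded (L ` {0..})"
    using assms(1) by (auto simp: remains_bounded_def)
  then show ?thesis
    unfolding remains_bounded_def
    by (intro exI[of _ "\<lambda>t. \<chi> i. L t $ p i"] conjI restricted_euler_solution_permute assms(2))
      (auto simp: bounded_vec_image_iff)
qed

lemma remains_bounded_permute_iff:
  assumes "p permutes UNIV"
  shows "remains_bounded (\<chi> i. L0 $ p i) \<longleftrightarrow> remains_bounded L0"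
proof
  assume "remains_bounded (\<chi> i. L0 $ p i)"
  from remains_bounded_permute[OF this permutes_inv[OF assms]] show "remains_bounded L0"
    by (simp add: permutes_inverses(1)[OF assms])
qed (rule remains_bounded_permute[OF _ assms])

text \<open>
A conjugation symmetry of the initial data (up to a permutation of the entries) persists in time,
because the conjugated and permuted solution solves the same initial value problem.
\<close>

lemma restricted_euler_solution_cnj_symmetric:
  assumes L: "restricted_euler_solution L0 L" "bounded (L ` {0..})"
    and p: "p permutes UNIV" and sym: "\<And>i. cnj (L0 $ p i) = L0 $ i" and t: "0 \<le> t"
  shows "cnj (L t $ p i) = L t $ i"
proof -
  define M where "M t = (\<chi> i. cnj (L t $ p i))" for t
  have *: "restricted_euler_solution (\<chi> i. L0 $ p i) (\<lambda>t. \<chi> i. L t $ p i)"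
    by (rule restricted_euler_solution_permute[OF L(1) p])
  have "((\<lambda>s. M s $ i) has_vector_derivative
      (1/4) * (\<Sum>j\<in>UNIV. (M t $ j)\<^sup>2) - (M t $ i)\<^sup>2) (at t within {0..})" if "0 \<le> t" for t i
    using * has_vector_derivative_cnj[of "\<lambda>s. L s $ p i"
        "(1/4) * (\<Sum>j\<in>UNIV. (L t $ p j)\<^sup>2) - (L t $ p i)\<^sup>2"] that
    by (simp add: restricted_euler_solution_def M_def)
  then have "restricted_euler_solution L0 M"
    using L(1) sym by (simp add: restricted_euler_solution_def M_def Finite_Cartesian_Product.vec_eq_iff)
  moreover have "bounded (M ` {0..})"
    using L(2) unfolding bounded_vec_image_iff by (simp add: M_def bounded_iff)
  ultimately have "M t = L t"
    using restricted_euler_solution_unique L t by blast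
  then show ?thesis by (simp add: M_def Finite_Cartesian_Product.vec_eq_iff)
qed

lemma restricted_euler_solution_sum_eq_0:
  assumes L: "restricted_euler_solution L0 L" and "(\<Sum>j\<in>UNIV. L0 $ j) = 0" and t: "0 \<le> t"
  shows "(\<Sum>j\<in>UNIV. L t $ j) = 0"
proof -
  have "((\<lambda>s. \<Sum>j\<in>UNIV. L s $ j) has_vector_derivative 0) (at s within {0..})" if "0 \<le> s" for s
  proof -
    have "((\<lambda>s. \<Sum>j\<in>UNIV. L s $ j) has_vector_derivative
        (\<Sum>i\<in>UNIV. (1/4) * (\<Sum>j\<in>UNIV. (L s $ j)\<^sup>2) - (L s $ i)\<^sup>2)) (at s within {0..})"
      using L that by (intro has_vector_derivative_sum) (auto simp: restricted_euler_solution_def)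
    moreover have "(\<Sum>i\<in>UNIV. (1/4) * (\<Sum>j\<in>UNIV. (L s $ j)\<^sup>2) - (L s $ i)\<^sup>2) = 0"
      by (simp add: sum_subtractf)
    ultimately show ?thesis by simp
  qed
  from has_vector_derivative_atLeast_zero_imp_constant[OF this t] show ?thesis
    using L assms(2) by (simp add: restricted_euler_solution_def)
qed

lemma restricted_euler_solution_Re_Im:
  assumes "restricted_euler_solution L0 L" "0 \<le> t"
  shows "((\<lambda>s. Re (L s $ i)) has_real_derivative
      (\<Sum>j\<in>UNIV. Re ((L t $ j)\<^sup>2)) / 4 - Re ((L t $ i)\<^sup>2)) (at t within {0..})"
    and "((\<lambda>s. Im (L s $ i)) has_real_derivative
      (\<Sum>j\<in>UNIV. Im ((L t $ j)\<^sup>2)) / 4 - Im ((L t $ i)\<^sup>2)) (at t within {0..})"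
proof -
  have "((\<lambda>s. L s $ i) has_vector_derivative
      (1/4) * (\<Sum>j\<in>UNIV. (L t $ j)\<^sup>2) - (L t $ i)\<^sup>2) (at t within {0..})"
    using assms by (simp add: restricted_euler_solution_def)
  from this[unfolded has_vector_derivative_complex_iff]
  show "((\<lambda>s. Re (L s $ i)) has_real_derivative
      (\<Sum>j\<in>UNIV. Re ((L t $ j)\<^sup>2)) / 4 - Re ((L t $ i)\<^sup>2)) (at t within {0..})"
    and "((\<lambda>s. Im (L s $ i)) has_real_derivative
      (\<Sum>j\<in>UNIV. Im ((L t $ j)\<^sup>2)) / 4 - Im ((L t $ i)\<^sup>2)) (at t within {0..})"
    by simp_all
qed

section \<open>Unbounded solutions\<close>

text \<open>
With eigenvalues \<open>a \<plusminus> i b\<close> and real \<open>u\<close>, \<open>v\<close>, the quantity \<open>b (u - v)\<close> is conserved, while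
\<open>a' = b\<^sup>2 / 2 + (u - v)\<^sup>2 / 8\<close> is at least half of its absolute value. If \<open>b\<close> and \<open>u - v\<close> are
initially nonzero, \<open>a\<close> therefore grows at least linearly.
\<close>

lemma bounded_complex_pair_imp_double_real:
  assumes L: "restricted_euler_solution L0 L" "bounded (L ` {0..})"
    and sum0: "(\<Sum>j\<in>UNIV. L0 $ j) = 0"
    and pair: "L0 $ 2 = cnj (L0 $ 1)" "Im (L0 $ 1) \<noteq> 0"
    and reals: "Im (L0 $ 3) = 0" "Im (L0 $ 4) = 0"
  shows "L0 $ 3 = L0 $ 4"
proof (rule ccontr)
  assume "L0 $ 3 \<noteq> L0 $ 4"
  then have neq: "Re (L0 $ 3) \<noteq> Re (L0 $ 4)" using reals by (simp add: complex_eq_iff)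
  define a b u v where "a t = Re (L t $ 1)" "b t = Im (L t $ 1)"
    "u t = Re (L t $ 3)" "v t = Re (L t $ 4)" for t
  \<comment> \<open>Conjugation exchanges the first two entries and fixes the other two.\<close>
  have "cnj (L0 $ Transposition.transpose 1 2 i) = L0 $ i" for i
    using exhaust_4[of i] pair reals by (auto simp: complex_eq_iff Transposition.transpose_def)
  from restricted_euler_solution_cnj_symmetric[OF L permutes_swap_id[of 1 UNIV 2] this]
  have sym: "cnj (L t $ Transposition.transpose 1 2 i) = L t $ i" if "0 \<le> t" for t i
    using that by simp
  have L1: "L t $ 1 = Complex (a t) (b t)" and L2: "L t $ 2 = Complex (a t) (- b t)"
    and L3: "L t $ 3 = of_real (u t)" and L4: "L t $ 4 = of_real (v t)" if "0 \<le> t" for t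
    using sym[OF that, of 2] sym[OF that, of 3] sym[OF that, of 4]
    by (auto simp: complex_eq_iff a_b_u_v_def Transposition.transpose_def)
  have uv: "u t + v t = - 2 * a t" if "0 \<le> t" for t
    using restricted_euler_solution_sum_eq_0[OF L(1) sum0 that]
    by (simp add: sum_4 L1 L2 L3 L4 that complex_eq_iff)
  note der = restricted_euler_solution_Re_Im[OF L(1)]
  have a': "(a has_real_derivative (b t)\<^sup>2 / 2 + (u t - v t)\<^sup>2 / 8) (at t within {0..})"
    if "0 \<le> t" for t
  proof -
    have v: "v t = - 2 * a t - u t" using uv[OF that] by simp
    have "(\<Sum>j\<in>UNIV. Re ((L t $ j)\<^sup>2)) / 4 - Re ((L t $ 1)\<^sup>2)
        = (b t)\<^sup>2 / 2 + (u t - v t)\<^sup>2 / 8"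
      unfolding sum_4 L1[OF that] L2[OF that] L3[OF that] L4[OF that]
      by (simp add: v power2_eq_square field_simps)
    with der(1)[OF that, of 1] show ?thesis by (simp add: a_b_u_v_def[abs_def])
  qed
  have b': "(b has_real_derivative - 2 * a t * b t) (at t within {0..})" if "0 \<le> t" for t
  proof -
    have "(\<Sum>j\<in>UNIV. Im ((L t $ j)\<^sup>2)) / 4 - Im ((L t $ 1)\<^sup>2) = - 2 * a t * b t"
      unfolding sum_4 L1[OF that] L2[OF that] L3[OF that] L4[OF that] by (simp add: Im_power2)
    with der(2)[OF that, of 1] show ?thesis by (simp add: a_b_u_v_def[abs_def])
  qed
  have uv': "((\<lambda>s. u s - v s) has_real_derivative (v t)\<^sup>2 - (u t)\<^sup>2) (at t within {0..})"
    if "0 \<le> t" for t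
  proof -
    have "((\<lambda>s. u s - v s) has_real_derivative Re ((L t $ 4)\<^sup>2) - Re ((L t $ 3)\<^sup>2))
        (at t within {0..})"
      unfolding a_b_u_v_def
      by (rule DERIV_cong[OF DERIV_diff[OF der(1)[OF that] der(1)[OF that]]]) simp
    then show ?thesis by (simp add: L3[OF that] L4[OF that])
  qed
  have "((\<lambda>s. b s * (u s - v s)) has_vector_derivative 0) (at t within {0..})" if "0 \<le> t" for t
  proof -
    have v: "v t = - 2 * a t - u t" using uv[OF that] by simp
    show ?thesis
      unfolding has_real_derivative_iff_has_vector_derivative[symmetric]
      by (rule DERIV_cong[OF DERIV_mult[OF b'[OF that] uv'[OF that]]])
        (simp add: v power2_eq_square algebra_simps)
  qed
  then have K: "b t * (u t - v t) = b 0 * (u 0 - v 0)" if "0 \<le> t" for t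
    using that by (rule has_vector_derivative_atLeast_zero_imp_constant)
  define e where "e = \<bar>b 0 * (u 0 - v 0)\<bar> / 2"
  have L0: "L 0 = L0" using L(1) by (simp add: restricted_euler_solution_def)
  have "\<not> bounded (a ` {0..})"
  proof (rule derivative_bounded_below_imp_unbounded)
    show "0 < e" using neq pair(2) by (simp add: e_def a_b_u_v_def L0)
    show "(a has_vector_derivative (b t)\<^sup>2 / 2 + (u t - v t)\<^sup>2 / 8) (at t within {0..})"
      if "0 \<le> t" for t
      using a'[OF that] by (simp add: has_real_derivative_iff_has_vector_derivative)
    show "e \<le> (b t)\<^sup>2 / 2 + (u t - v t)\<^sup>2 / 8" if "0 \<le> t" for t
    proof -
      have "e = \<bar>b t * (u t - v t)\<bar> / 2" using K[OF that] by (simp add: e_def)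
      moreover have "0 \<le> (\<bar>b t\<bar> - \<bar>u t - v t\<bar> / 2)\<^sup>2" by simp
      ultimately show ?thesis by (simp add: power2_diff abs_mult power_divide)
    qed
  qed
  moreover have "bounded (a ` {0..})"
    using L(2) unfolding a_b_u_v_def by (rule bounded_Re_component)
  ultimately show False by contradiction
qed

text \<open>
For real eigenvalues with \<open>x\<^sub>4 < x\<^sub>3 \<le> x\<^sub>1, x\<^sub>2\<close> these inequalities persist, and the trace
condition turns \<open>(x\<^sub>3 - x\<^sub>4)' = - (x\<^sub>3 + x\<^sub>4) (x\<^sub>3 - x\<^sub>4)\<close> into
\<open>(x\<^sub>3 - x\<^sub>4)' \<ge> (x\<^sub>3 - x\<^sub>4)\<^sup>2 / 2\<close>, so that the gap between the two smallest eigenvalues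
grows beyond all bounds.
\<close>

lemma bounded_real_imp_double_minimum:
  assumes L: "restricted_euler_solution L0 L" "bounded (L ` {0..})"
    and sum0: "(\<Sum>j\<in>UNIV. L0 $ j) = 0" and real: "\<And>i. Im (L0 $ i) = 0"
    and ord: "Re (L0 $ 4) \<le> Re (L0 $ 3)" "Re (L0 $ 3) \<le> Re (L0 $ 1)" "Re (L0 $ 3) \<le> Re (L0 $ 2)"
  shows "L0 $ 3 = L0 $ 4"
proof (rule ccontr)
  assume "L0 $ 3 \<noteq> L0 $ 4"
  then have lt: "Re (L0 $ 4) < Re (L0 $ 3)" using ord real by (simp add: complex_eq_iff)
  define x where "x i t = Re (L t $ i)" for i t
  have "cnj (L t $ id i) = L t $ i" if "0 \<le> t" for t i
    by (rule restricted_euler_solution_cnj_symmetric[OF L permutes_id _ that])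
      (simp add: complex_eq_iff real)
  then have Lx: "L t $ i = of_real (x i t)" if "0 \<le> t" for t i
    using that by (auto simp: complex_eq_iff x_def)
  have x0: "x i 0 = Re (L0 $ i)" for i
    using L(1) by (simp add: restricted_euler_solution_def x_def)
  have sum: "x 1 t + x 2 t + x 3 t + x 4 t = 0" if "0 \<le> t" for t
    using restricted_euler_solution_sum_eq_0[OF L(1) sum0 that]
    by (simp add: sum_4 Lx that complex_eq_iff)
  have x': "(x i has_real_derivative (\<Sum>j\<in>UNIV. (x j t)\<^sup>2) / 4 - (x i t)\<^sup>2) (at t within {0..})"
    if "0 \<le> t" for i t
    using restricted_euler_solution_Re_Im(1)[OF L(1) that, of i]
    by (simp add: Lx that flip: x_def)
  have d': "((\<lambda>s. x i s - x j s) has_vector_derivative - (x i t + x j t) * (x i t - x j t))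
      (at t within {0..})" if "0 \<le> t" for i j t
    unfolding has_real_derivative_iff_has_vector_derivative[symmetric]
    by (rule DERIV_cong[OF DERIV_diff[OF x'[OF that] x'[OF that]]])
      (simp add: power2_eq_square algebra_simps)
  have cont: "continuous_on {0..} (x i)" for i
    using x' DERIV_continuous unfolding continuous_on_eq_continuous_within by blast
  have d: "x i t - x j t = (x i 0 - x j 0) * exp (integral {0..t} (\<lambda>s. - (x i s + x j s)))"
    if "0 \<le> t" for i j t
    by (rule scalar_linear_ode_solution[OF d' _ that]) (auto intro!: continuous_intros cont)
  have mono: "x j t \<le> x i t" if "x j 0 \<le> x i 0" "0 \<le> t" for i j t
  proof -
    have "0 \<le> x i t - x j t" unfolding d[OF that(2)] using that(1) by simp
    then show ?thesis by simp
  qed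
  have ge: "x 3 t \<le> x 1 t" "x 3 t \<le> x 2 t" "x 4 t \<le> x 3 t" if "0 \<le> t" for t
    using mono[OF _ that] ord by (simp_all add: x0)
  define \<delta> where "\<delta> = x 3 0 - x 4 0"
  have \<delta>: "0 < \<delta>" using lt by (simp add: \<delta>_def x0)
  have sq: "(x 3 t - x 4 t)\<^sup>2 / 2 \<le> - (x 3 t + x 4 t) * (x 3 t - x 4 t)" if "0 \<le> t" for t
  proof -
    have "(x 3 t - x 4 t) / 2 * (x 3 t - x 4 t) \<le> - (x 3 t + x 4 t) * (x 3 t - x 4 t)"
    proof (rule mult_right_mono)
      show "0 \<le> x 3 t - x 4 t" using ge(3)[OF that] by simp
      show "(x 3 t - x 4 t) / 2 \<le> - (x 3 t + x 4 t)"
        using sum[OF that] ge(1,2)[OF that] by argo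
    qed
    then show ?thesis by (simp add: power2_eq_square)
  qed
  have \<delta>_le: "\<delta> \<le> x 3 t - x 4 t" if t: "0 \<le> t" for t
  proof -
    obtain s where s: "0 \<le> s"
      "(x 3 t - x 4 t) - (x 3 0 - x 4 0) = t * (- (x 3 s + x 4 s) * (x 3 s - x 4 s))"
      by (rule mvt_atLeast[OF d', of t 3 4]) (use t in auto)
    have "0 \<le> - (x 3 s + x 4 s) * (x 3 s - x 4 s)"
      using sq[OF s(1)] by (rule order_trans[rotated]) simp
    from mult_nonneg_nonneg[OF t this] show ?thesis
      using s(2) by (simp add: \<delta>_def)
  qed
  have "\<not> bounded ((\<lambda>t. x 3 t - x 4 t) ` {0..})"
  proof (rule derivative_bounded_below_imp_unbounded[OF d'])
    show "0 < \<delta>\<^sup>2 / 2" using \<delta> by simp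
    show "\<delta>\<^sup>2 / 2 \<le> - (x 3 t + x 4 t) * (x 3 t - x 4 t)" if "0 \<le> t" for t
      using sq[OF that] power_mono[OF \<delta>_le[OF that], of 2] \<delta> by linarith
  qed
  moreover have "bounded (x i ` {0..})" for i
    using L(2) unfolding x_def by (rule bounded_Re_component)
  ultimately show False using bounded_minus_comp by blast
qed

section \<open>Bounded solutions\<close>

text \<open>
The system in the coordinates \<open>(2 a, b, c)\<close> of the eigenvalues \<open>a \<plusminus> i b, - a \<plusminus> i c\<close>: it reads
\<open>x' = pair_bilinear x x\<close>, that is \<open>p' = q\<^sup>2 - r\<^sup>2, q' = - p q, r' = p r\<close> for \<open>x = (p, q, r)\<close>. The factor
\<open>2\<close> makes the conserved quantity \<open>4 a\<^sup>2 + b\<^sup>2 + c\<^sup>2\<close> the square of the Euclidean norm.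
\<close>

definition pair_bilinear ::
  "real \<times> real \<times> real \<Rightarrow> real \<times> real \<times> real \<Rightarrow> real \<times> real \<times> real" where
  "pair_bilinear x y = (fst (snd x) * fst (snd y) - snd (snd x) * snd (snd y),
     - (fst x * fst (snd y)), fst x * snd (snd y))"

lemma bilinear_pair_bilinear: "bilinear pair_bilinear"
  unfolding bilinear_def
  by (auto intro!: linearI simp: pair_bilinear_def algebra_simps)

lemma inner_pair_bilinear: "x \<bullet> pair_bilinear x x = 0"
  by (simp add: pair_bilinear_def inner_prod_def algebra_simps)

text \<open>
No condition on \<open>b\<close> and \<open>c\<close> is needed; \<open>c = 0\<close> covers one pair with a double real eigenvalue.
\<close>

lemma remains_bounded_two_pairs:
  "remains_bounded (vector [Complex a b, Complex a (- b), Complex (- a) c, Complex (- a) (- c)])"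
proof -
  obtain x where x0: "x 0 = (2 * a, b, c)"
    and x': "\<And>t. 0 \<le> t \<Longrightarrow> (x has_vector_derivative pair_bilinear (x t) (x t)) (at t within {0..})"
    and nx: "\<And>t. 0 \<le> t \<Longrightarrow> norm (x t) = norm (2 * a, b, c)"
    using norm_preserving_quadratic_ode_solution_exists[OF bilinear_pair_bilinear inner_pair_bilinear]
    by blast
  define p q r where "p t = fst (x t)" "q t = fst (snd (x t))" "r t = snd (snd (x t))" for t
  have p': "(p has_real_derivative (q t)\<^sup>2 - (r t)\<^sup>2) (at t within {0..})"
    and q': "(q has_real_derivative - (p t * q t)) (at t within {0..})"
    and r': "(r has_real_derivative p t * r t) (at t within {0..})" if "0 \<le> t" for t
    unfolding has_real_derivative_iff_has_vector_derivative
    using bounded_linear.has_vector_derivative[OF bounded_linear_fst x'[OF that]]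
      bounded_linear.has_vector_derivative[OF
        bounded_linear_compose[OF bounded_linear_fst bounded_linear_snd] x'[OF that]]
      bounded_linear.has_vector_derivative[OF
        bounded_linear_compose[OF bounded_linear_snd bounded_linear_snd] x'[OF that]]
    by (simp_all add: p_q_r_def[abs_def] pair_bilinear_def power2_eq_square)
  define L :: "real \<Rightarrow> complex ^ 4" where
    "L t = vector [Complex (p t / 2) (q t), Complex (p t / 2) (- q t),
       Complex (- p t / 2) (r t), Complex (- p t / 2) (- r t)]" for t
  have "((\<lambda>s. L s $ i) has_vector_derivative
      (1/4) * (\<Sum>j\<in>UNIV. (L t $ j)\<^sup>2) - (L t $ i)\<^sup>2) (at t within {0..})" if t: "0 \<le> t" for i t
  proof -
    have *: "(\<Sum>j\<in>UNIV. (L t $ j)\<^sup>2) = of_real ((p t)\<^sup>2 - 2 * (q t)\<^sup>2 - 2 * (r t)\<^sup>2)"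
      by (simp add: L_def sum_4 complex_eq_iff Re_power2 Im_power2 power_divide)
    note der = p'[OF t] q'[OF t] r'[OF t]
    show ?thesis
      unfolding * has_vector_derivative_complex_iff
      using exhaust_4[of i]
      by (elim disjE; simp add: L_def)
        (auto intro!: derivative_eq_intros der simp: Re_power2 Im_power2 power_divide field_simps)
  qed
  moreover have "L 0 = vector [Complex a b, Complex a (- b), Complex (- a) c, Complex (- a) (- c)]"
    by (simp add: L_def p_q_r_def x0)
  moreover have "bounded (L ` {0..})"
  proof -
    define R where "R = norm (2 * a, b, c)"
    have pqr: "\<bar>p t\<bar> \<le> R" "\<bar>q t\<bar> \<le> R" "\<bar>r t\<bar> \<le> R" if "0 \<le> t" for t
      using norm_fst_le[of "fst (x t)" "snd (x t)"] norm_snd_le[of "snd (x t)" "fst (x t)"]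
        norm_fst_le[of "fst (snd (x t))" "snd (snd (x t))"]
        norm_snd_le[of "snd (snd (x t))" "fst (snd (x t))"] nx[OF that]
      by (auto simp: p_q_r_def R_def)
    have "cmod (L t $ i) \<le> 2 * R" if "0 \<le> t" for t i
      using pqr[OF that] exhaust_4[of i] cmod_le[of "L t $ i"] by (auto simp: L_def)
    then show ?thesis unfolding bounded_vec_image_iff by (auto simp: bounded_iff)
  qed
  ultimately show ?thesis
    unfolding remains_bounded_def restricted_euler_solution_def by blast
qed

text \<open>
A nonnegative initial slope keeps the solution of \<open>D'' = k\<^sup>2 D\<close>, \<open>D 0 = 1\<close> away from zero on the
half-line.
\<close>

lemma linear_second_order_solution:
  fixes a k :: real
  assumes "0 \<le> a" "0 \<le> k"
  obtains D D' where "D 0 = 1" "D' 0 = a"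
    and "\<And>t. (D has_real_derivative D' t) (at t)"
    and "\<And>t. (D' has_real_derivative k\<^sup>2 * D t) (at t)"
    and "\<And>t. 0 \<le> t \<Longrightarrow> 1 \<le> D t" "\<And>t. 0 \<le> t \<Longrightarrow> 0 \<le> D' t"
proof (cases "k = 0")
  case True
  show ?thesis
    by (rule that[of "\<lambda>t. 1 + a * t" "\<lambda>t. a"])
      (use assms True in \<open>auto intro!: derivative_eq_intros\<close>)
next
  case False
  show ?thesis
    by (rule that[of "\<lambda>t. cosh (k * t) + a / k * sinh (k * t)"
          "\<lambda>t. k * sinh (k * t) + a * cosh (k * t)"])
      (use assms False cosh_real_ge_1 in \<open>auto intro!: derivative_eq_intros add_increasing2
         simp: power2_eq_square algebra_simps\<close>)
qed

text \<open>
For eigenvalues \<open>p / 2 + q, p / 2 - q, - p / 2, - p / 2\<close> the system is \<open>p' = - q\<^sup>2, q' = - p q\<close>, and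
\<open>p\<^sup>2 - q\<^sup>2 = k\<^sup>2\<close> is conserved. Hence \<open>p\<close> solves the Riccati equation \<open>p' = k\<^sup>2 - p\<^sup>2\<close>, which
\<open>p = D' / D\<close> with \<open>D'' = k\<^sup>2 D\<close> linearizes; then \<open>q = b / D\<close>. The conditions on \<open>a\<close> and \<open>b\<close> make
\<open>k\<close> real and the initial slope \<open>2 a\<close> of \<open>D\<close> nonnegative.
\<close>

lemma remains_bounded_real:
  assumes "0 \<le> a" "\<bar>b\<bar> \<le> 2 * a"
  shows "remains_bounded (vector [complex_of_real (a + b), complex_of_real (a - b),
    complex_of_real (- a), complex_of_real (- a)])"
proof -
  define k where "k = sqrt ((2 * a)\<^sup>2 - b\<^sup>2)"
  have "b\<^sup>2 \<le> (2 * a)\<^sup>2" using assms abs_le_square_iff[of b "2 * a"] by simp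
  then have k: "0 \<le> k" "k\<^sup>2 = (2 * a)\<^sup>2 - b\<^sup>2" by (simp_all add: k_def)
  obtain D D' where D: "D 0 = 1" "D' 0 = 2 * a"
    "\<And>t. (D has_real_derivative D' t) (at t)"
    "\<And>t. (D' has_real_derivative k\<^sup>2 * D t) (at t)"
    and pos: "\<And>t. 0 \<le> t \<Longrightarrow> 1 \<le> D t" "\<And>t. 0 \<le> t \<Longrightarrow> 0 \<le> D' t"
    using linear_second_order_solution[of "2 * a" k] assms(1) k(1) by auto
  have energy: "(D' t)\<^sup>2 - k\<^sup>2 * (D t)\<^sup>2 = b\<^sup>2" if "0 \<le> t" for t
  proof -
    have "((\<lambda>t. (D' t)\<^sup>2 - k\<^sup>2 * (D t)\<^sup>2) has_vector_derivative 0) (at s within {0..})" for s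
      unfolding has_real_derivative_iff_has_vector_derivative[symmetric]
      by (rule has_field_derivative_at_within) (auto intro!: derivative_eq_intros D)
    from has_vector_derivative_atLeast_zero_imp_constant[OF this that]
    show ?thesis by (simp add: D k)
  qed
  define p q where "p t = D' t / D t" "q t = b / D t" for t
  have pq: "(p t)\<^sup>2 = k\<^sup>2 + (q t)\<^sup>2" if "0 \<le> t" for t
    using energy[OF that] pos(1)[OF that] by (simp add: p_q_def field_simps)
  have p': "(p has_real_derivative - (q t)\<^sup>2) (at t within {0..})"
    and q': "(q has_real_derivative - (p t * q t)) (at t within {0..})" if "0 \<le> t" for t
  proof -
    have D0: "D t \<noteq> 0" using pos(1)[OF that] by simp
    have "(p has_real_derivative k\<^sup>2 - (p t)\<^sup>2) (at t)"
      unfolding p_q_def[abs_def]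
      by (rule DERIV_cong[OF DERIV_divide[OF D(4) D(3) D0]])
        (use D0 in \<open>simp add: field_simps power2_eq_square\<close>)
    then show "(p has_real_derivative - (q t)\<^sup>2) (at t within {0..})"
      using pq[OF that] by (auto intro: has_field_derivative_at_within)
    show "(q has_real_derivative - (p t * q t)) (at t within {0..})"
      unfolding p_q_def[abs_def]
      by (rule has_field_derivative_at_within,
          rule DERIV_cong[OF DERIV_divide[OF DERIV_const D(3) D0]])
        (use D0 in \<open>simp add: field_simps power2_eq_square\<close>)
  qed
  define L :: "real \<Rightarrow> complex ^ 4" where
    "L t = vector [of_real (p t / 2 + q t), of_real (p t / 2 - q t),
       of_real (- p t / 2), of_real (- p t / 2)]" for t
  have "((\<lambda>s. L s $ i) has_vector_derivative
      (1/4) * (\<Sum>j\<in>UNIV. (L t $ j)\<^sup>2) - (L t $ i)\<^sup>2) (at t within {0..})" if t: "0 \<le> t" for i t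
  proof -
    have *: "(\<Sum>j\<in>UNIV. (L t $ j)\<^sup>2) = of_real ((p t)\<^sup>2 + 2 * (q t)\<^sup>2)"
      by (simp add: L_def sum_4 complex_eq_iff Re_power2 Im_power2 power2_eq_square field_simps)
    note der = p'[OF t] q'[OF t]
    show ?thesis
      unfolding * has_vector_derivative_complex_iff
      using exhaust_4[of i]
      by (elim disjE; simp add: L_def)
        (auto intro!: derivative_eq_intros der simp: Re_power2 Im_power2 power2_eq_square field_simps)
  qed
  moreover have "L 0 = vector [of_real (a + b), of_real (a - b), of_real (- a), of_real (- a)]"
    by (simp add: L_def p_q_def D)
  moreover have "bounded (L ` {0..})"
  proof -
    have q: "\<bar>q t\<bar> \<le> \<bar>b\<bar>" if "0 \<le> t" for t
      using pos(1)[OF that] mult_left_mono[OF pos(1)[OF that], of "\<bar>b\<bar>"]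
      by (simp add: p_q_def abs_divide divide_le_eq)
    have p: "\<bar>p t\<bar> \<le> \<bar>2 * a\<bar>" if "0 \<le> t" for t
      using pq[OF that] q[OF that] k(2) by (simp add: abs_le_square_iff)
    have "cmod (L t $ i) \<le> 2 * \<bar>a\<bar> + \<bar>b\<bar>" if "0 \<le> t" for t i
      using p[OF that] q[OF that] exhaust_4[of i]
      by (auto simp: L_def simp del: of_real_add of_real_diff of_real_divide of_real_minus)
    then show ?thesis unfolding bounded_vec_image_iff by (auto simp: bounded_iff)
  qed
  ultimately show ?thesis
    unfolding remains_bounded_def restricted_euler_solution_def by blast
qed

section \<open>Eigenvalue lists of real matrices\<close>

lemma ex_permutes_two_points:
  fixes i j k l :: 'a
  assumes "i \<noteq> j" "k \<noteq> l"
  obtains p where "p permutes UNIV" "p i = k" "p j = l"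
proof -
  define q where "q = Transposition.transpose i k"
  have q: "q permutes UNIV" "q i = k"
    by (simp_all add: q_def permutes_swap_id)
  have "q j \<noteq> k" using q assms(1) by (metis permutes_inj injD)
  show ?thesis
  proof
    show "Transposition.transpose (q j) l \<circ> q permutes UNIV"
      by (intro permutes_compose q permutes_swap_id) auto
    show "(Transposition.transpose (q j) l \<circ> q) i = k" "(Transposition.transpose (q j) l \<circ> q) j = l"
      using q \<open>q j \<noteq> k\<close> assms(2) by (simp_all add: transpose_apply_other)
  qed
qed

text \<open>
The list is closed under conjugation with multiplicities, expressed through the product of its
linear factors.
\<close>

lemma eigenvalue_list_cnj:
  assumes "eigenvalue_list A L"
  shows "(\<Prod>j\<in>UNIV. [:- cnj (L $ j), 1:]) = (\<Prod>j\<in>UNIV. [:- (L $ j), 1:])"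
proof (subst poly_eq_poly_eq_iff[symmetric], rule ext)
  fix z
  have A: "A \<in> carrier_mat 4 4"
    and "char_poly (map_mat complex_of_real A) = (\<Prod>j\<in>UNIV. [:- (L $ j), 1:])"
    using assms by (auto simp: eigenvalue_list_def)
  then have *: "(\<Prod>j\<in>UNIV. [:- (L $ j), 1:]) = map_poly complex_of_real (char_poly A)"
    by (simp add: of_real_hom.char_poly_hom[OF A])
  have real: "poly (map_poly complex_of_real P) (cnj w) = cnj (poly (map_poly complex_of_real P) w)"
    for P w
    by (induction P) (auto simp: map_poly_pCons)
  have "poly (\<Prod>j\<in>UNIV. [:- cnj (L $ j), 1:]) z = cnj (poly (\<Prod>j\<in>UNIV. [:- (L $ j), 1:]) (cnj z))"
    by (simp add: poly_prod)
  also have "\<dots> = poly (\<Prod>j\<in>UNIV. [:- (L $ j), 1:]) z"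
    unfolding * real[symmetric] by simp
  finally show "poly (\<Prod>j\<in>UNIV. [:- cnj (L $ j), 1:]) z = poly (\<Prod>j\<in>UNIV. [:- (L $ j), 1:]) z" .
qed

lemma prod_4: "prod f (UNIV :: 4 set) = f 1 * f 2 * f 3 * f 4"
  unfolding UNIV_4 by (simp add: mult.assoc)

text \<open>
In the real case the entries are arranged with the smallest one in position 4 and the second
smallest in position 3; positions 1 and 2 are not ordered.
\<close>

lemma eigenvalue_list_normal_form:
  assumes "eigenvalue_list A L"
  obtains (two_pairs) p where "p permutes UNIV" "Im (L $ p 1) \<noteq> 0"
      "L $ p 2 = cnj (L $ p 1)" "L $ p 4 = cnj (L $ p 3)"
  | (one_pair) p where "p permutes UNIV" "Im (L $ p 1) \<noteq> 0"
      "L $ p 2 = cnj (L $ p 1)" "Im (L $ p 3) = 0" "Im (L $ p 4) = 0"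
  | (all_real) p where "p permutes UNIV" "\<And>i. Im (L $ p i) = 0"
      "Re (L $ p 4) \<le> Re (L $ p 3)" "Re (L $ p 3) \<le> Re (L $ p 1)" "Re (L $ p 3) \<le> Re (L $ p 2)"
proof (cases "\<forall>i. Im (L $ i) = 0")
  case True
  obtain n where n: "\<And>i. Re (L $ n) \<le> Re (L $ i)"
    using ex_min_if_finite[of "range (\<lambda>i. Re (L $ i))"] by (auto simp: not_less)
  have "UNIV - {n} \<noteq> {}"
    using UNIV_4 by (metis Diff_eq_empty_iff UNIV_I insertE empty_iff subsetD zero_neq_one)
  then obtain m where m: "m \<noteq> n" "\<And>i. i \<noteq> n \<Longrightarrow> Re (L $ m) \<le> Re (L $ i)"
    using ex_min_if_finite[of "(\<lambda>i. Re (L $ i)) ` (UNIV - {n})"] by (auto simp: not_less)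
  obtain p where p: "p permutes UNIV" "p 4 = n" "p 3 = m"
    using ex_permutes_two_points[of 4 3 n m] m(1) by auto
  have "p 1 \<noteq> p 4" "p 2 \<noteq> p 4"
    by (simp_all add: inj_eq[OF permutes_inj[OF p(1)]])
  with all_real[OF p(1)] show thesis using True n m p by auto
next
  case False
  then obtain m where m: "Im (L $ m) \<noteq> 0" by blast
  let ?f = "\<lambda>z. [:- z, 1:]"
  have cnj: "(\<Prod>j\<in>UNIV. ?f (cnj (L $ j))) = (\<Prod>j\<in>UNIV. ?f (L $ j))"
    by (rule eigenvalue_list_cnj[OF assms])
  have "poly (\<Prod>j\<in>UNIV. ?f (cnj (L $ j))) (cnj (L $ m)) = 0"
    by (auto simp: poly_prod)
  then obtain n where n: "L $ n = cnj (L $ m)"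
    unfolding cnj by (auto simp: poly_prod)
  have "n \<noteq> m" using n m by (auto simp: complex_eq_iff)
  then obtain p where p: "p permutes UNIV" "p 1 = m" "p 2 = n"
    using ex_permutes_two_points[of 1 2 m n] by auto
  let ?w = "L $ p 3" and ?z = "L $ p 4"
  have perm: "(\<Prod>j\<in>UNIV. g (L $ j)) = g (L $ m) * g (L $ n) * g ?w * g ?z"
    for g :: "complex \<Rightarrow> complex poly"
    using prod.permute[OF p(1), of "\<lambda>j. g (L $ j)"] by (simp add: prod_4 p)
  have "?f (L $ m) * ?f (L $ n) * (?f (cnj ?w) * ?f (cnj ?z))
      = ?f (L $ m) * ?f (L $ n) * (?f ?w * ?f ?z)"
    using cnj unfolding perm[of ?f] perm[of "\<lambda>z. ?f (cnj z)"] n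
    by (simp only: complex_cnj_cnj mult_ac)
  \<comment> \<open>Cancelling the conjugate pair leaves the same conjugation invariance for the other
      two entries.\<close>
  then have eq: "?f (cnj ?w) * ?f (cnj ?z) = ?f ?w * ?f ?z"
    by (simp only: mult_cancel_left) auto
  have "(?w - cnj ?w) * (?w - cnj ?z) = 0"
    using arg_cong[OF eq, of "\<lambda>q. poly q ?w"] by (simp add: algebra_simps)
  then have "?w = cnj ?w \<or> ?w = cnj ?z" by simp
  then show thesis
  proof
    assume w: "?w = cnj ?w"
    \<comment> \<open>The linear coefficient shows that \<open>?w + ?z\<close> is real.\<close>
    from arg_cong[OF eq, of "\<lambda>q. coeff q 1"] w have "?z = cnj ?z" by (simp add: complex_eq_iff)
    with w show thesis using one_pair[OF p(1)] m n p by (simp add: complex_eq_iff)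
  next
    assume "?w = cnj ?z"
    then show thesis using two_pairs[OF p(1)] m n p by simp
  qed
qed

section \<open>Characterization of the bounded solutions\<close>

theorem theorem1p2:
  fixes A :: "real mat" and L0 :: "complex ^ 4"
  assumes "eigenvalue_list A L0"
    and "(\<Sum>j\<in>UNIV. L0 $ j) = 0"
  shows "remains_bounded L0 \<longleftrightarrow>
    (\<exists>p. p permutes UNIV \<and>
       (\<chi> i. L0 $ p i) \<in> two_complex_pairs \<union> complex_pair_double_real \<union> all_real)"
proof
  assume "\<exists>p. p permutes UNIV \<and>
    (\<chi> i. L0 $ p i) \<in> two_complex_pairs \<union> complex_pair_double_real \<union> all_real"
  then obtain p where p: "p permutes UNIV"
    and "(\<chi> i. L0 $ p i) \<in> two_complex_pairs \<union> complex_pair_double_real \<union> all_real" by blast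
  then have "remains_bounded (\<chi> i. L0 $ p i)"
  proof (elim UnE)
    assume "(\<chi> i. L0 $ p i) \<in> two_complex_pairs"
    then show ?thesis by (auto simp: two_complex_pairs_def remains_bounded_two_pairs)
  next
    assume "(\<chi> i. L0 $ p i) \<in> complex_pair_double_real"
    then obtain a b where "(\<chi> i. L0 $ p i) =
        vector [Complex a b, Complex a (- b), complex_of_real (- a), complex_of_real (- a)]"
      by (auto simp: complex_pair_double_real_def)
    then show ?thesis
      using remains_bounded_two_pairs[of a b 0] by (simp add: complex_of_real_def)
  next
    assume "(\<chi> i. L0 $ p i) \<in> all_real"
    then show ?thesis
      unfolding all_real_def using remains_bounded_real by fastforce
  qed
  then show "remains_bounded L0" by (simp only: remains_bounded_permute_iff[OF p])
next
  assume bdd: "remains_bounded L0"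
  have sol: "\<exists>L. restricted_euler_solution (\<chi> i. L0 $ p i) L \<and> bounded (L ` {0..})"
    and sum: "(\<Sum>j\<in>UNIV. (\<chi> i. L0 $ p i) $ j) = 0" if "p permutes UNIV" for p
    using remains_bounded_permute[OF bdd that] sum.permute[OF that, of "\<lambda>j. L0 $ j"] assms(2)
    by (simp_all add: remains_bounded_def o_def)
  from assms(1) show "\<exists>p. p permutes UNIV \<and>
    (\<chi> i. L0 $ p i) \<in> two_complex_pairs \<union> complex_pair_double_real \<union> all_real"
  proof (cases rule: eigenvalue_list_normal_form)
    case (two_pairs p)
    define a b c where "a = Re (L0 $ p 1)" "b = Im (L0 $ p 1)" "c = Im (L0 $ p 3)"
    have "Re (L0 $ p 3) = - a"
      using sum[OF two_pairs(1)] two_pairs by (simp add: sum_4 a_b_c_def complex_eq_iff)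
    then have M: "(\<chi> i. L0 $ p i) =
        vector [Complex a b, Complex a (- b), Complex (- a) c, Complex (- a) (- c)]"
      using two_pairs
      by (auto simp: Finite_Cartesian_Product.vec_eq_iff forall_4 complex_eq_iff a_b_c_def)
    have "b \<noteq> 0" using two_pairs by (simp add: a_b_c_def)
    show ?thesis
    proof (cases "c = 0")
      case True
      then have "(\<chi> i. L0 $ p i) \<in> complex_pair_double_real"
        using M \<open>b \<noteq> 0\<close> by (auto simp: complex_pair_double_real_def complex_of_real_def)
      with two_pairs(1) show ?thesis by blast
    next
      case False
      then have "(\<chi> i. L0 $ p i) \<in> two_complex_pairs"
        using M \<open>b \<noteq> 0\<close> by (auto simp: two_complex_pairs_def)
      with two_pairs(1) show ?thesis by blast
    qed
  next
    case (one_pair p)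
    obtain L where L: "restricted_euler_solution (\<chi> i. L0 $ p i) L" "bounded (L ` {0..})"
      using sol[OF one_pair(1)] by blast
    have eq: "L0 $ p 3 = L0 $ p 4"
      using bounded_complex_pair_imp_double_real[OF L sum[OF one_pair(1)]] one_pair by simp
    define a b where "a = Re (L0 $ p 1)" "b = Im (L0 $ p 1)"
    have "Re (L0 $ p 3) = - a"
      using sum[OF one_pair(1)] one_pair eq by (simp add: sum_4 a_b_def complex_eq_iff)
    then have "(\<chi> i. L0 $ p i) =
        vector [Complex a b, Complex a (- b), complex_of_real (- a), complex_of_real (- a)]"
      using one_pair eq
      by (auto simp: Finite_Cartesian_Product.vec_eq_iff forall_4 complex_eq_iff a_b_def)
    moreover have "b \<noteq> 0" using one_pair by (simp add: a_b_def)
    ultimately have "(\<chi> i. L0 $ p i) \<in> complex_pair_double_real"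
      by (auto simp: complex_pair_double_real_def)
    with one_pair(1) show ?thesis by blast
  next
    case (all_real p)
    obtain L where L: "restricted_euler_solution (\<chi> i. L0 $ p i) L" "bounded (L ` {0..})"
      using sol[OF all_real(1)] by blast
    have eq: "L0 $ p 3 = L0 $ p 4"
      using bounded_real_imp_double_minimum[OF L sum[OF all_real(1)]] all_real by simp
    define a b where "a = - Re (L0 $ p 3)" "b = (Re (L0 $ p 1) - Re (L0 $ p 2)) / 2"
    have sum': "Re (L0 $ p 1) + Re (L0 $ p 2) = 2 * a"
      using arg_cong[OF sum[OF all_real(1)], of Re] eq by (simp add: sum_4 a_b_def)
    then have "(\<chi> i. L0 $ p i) = vector [complex_of_real (a + b), complex_of_real (a - b),
        complex_of_real (- a), complex_of_real (- a)]"
      using all_real(2) eq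
      by (auto simp: Finite_Cartesian_Product.vec_eq_iff forall_4 complex_eq_iff a_b_def field_simps)
    moreover have "0 \<le> a" "b \<in> {- 2 * a..2 * a}"
      using sum' all_real(4,5) by (auto simp: a_b_def field_simps)
    ultimately have "(\<chi> i. L0 $ p i) \<in> all_real"
      unfolding all_real_def by blast
    with all_real(1) show ?thesis by blast
  qed
qed

end
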